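(* Let $m,n\ge1$ be integers, let $p_1,\dots,p_t\in\mathcal{P}_0^m(\mathbb{R}^n)$ ($t\ge1$) be non-zero jets, and let $I=\langle p_1,\dots,p_t\rangle_m$ be the ideal of $\mathcal{P}^m(\mathbb{R}^n)$ generated by them. Then $$Allow(I)\subset\bigcap_{i=1}^t\{\omega\in S^{n-1}: \hat p_i(\omega)=0\},$$ where $\hat p_i$ is the lowest degree homogeneous part of $p_i$. Moreover, if $p_1,\dots,p_t$ are all homogeneous polynomials, then $$Allow(I)=\bigcap_{i=1}^t\{\omega\in S^{n-1}: p_i(\omega)=0\}.$$
   Context: Jets: $\mathcal{P}^m(\mathbb{R}^n)$ is the ring of real polynomials in $n$ variables of degree at most $m$, with multiplication of $P$ and $Q$ given by $J^m(PQ)$, where $J^m$ denotes the Taylor polynomial of degree at most $m$ at the origin. $\mathcal{P}_0^m(\mathbb{R}^n)$ is the subset of those with zero constant term. For a non-zero $p\in\mathcal{P}_0^m(\mathbb{R}^n)$, write uniquely $p=p_k+q$ with $p_k\neq 0$ homogeneous of degree $k$ and $q$ a (possibly zero) polynomial all of whose monomials have degree $>k$; $p_k$ is the lowest degree homogeneous part of $p$. Allowed directions: for $\omega\in S^{n-1}$, $\delta,r>0$, let $\Gamma(\omega,\delta,r)=\{x\in\mathbb{R}^n: 0<|x|<r,\ |x/|x|-\omega|<\delta\}$. For an ideal $I$ of $\mathcal{P}^m(\mathbb{R}^n)$ contained in $\mathcal{P}_0^m(\mathbb{R}^n)$, a direction $\omega\in S^{n-1}$ is forbidden if there exist $q_1,\dots,q_L\in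 I$ and $c,\delta,r>0$ such that $|q_1(x)|+\dots+|q_L(x)|>c|x|^m$ for all $x\in\Gamma(\omega,\delta,r)$; otherwise it is allowed. $Allow(I)\subset S^{n-1}$ is the set of allowed directions. *)

theory Defs
  imports "HOL-Analysis.Analysis" "HOL-Library.Poly_Mapping" "HOL-Algebra.Ideal"
begin

text \<open>
  Real polynomials in variables indexed by a finite type \<open>'n\<close>, as finitely supported maps from
  exponent vectors to coefficients; addition and multiplication are those of
  \<^theory>\<open>HOL-Library.Poly_Mapping\<close> (multiplication is convolution).
\<close>

type_synonym 'n rpoly = "('n \<Rightarrow>\<^sub>0 nat) \<Rightarrow>\<^sub>0 real"

definition mdeg :: "('n::finite \<Rightarrow>\<^sub>0 nat) \<Rightarrow> nat" where
  "mdeg \<alpha> = (\<Sum>i\<in>UNIV. Poly_Mapping.lookup \<alpha> i)"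

definition eval_poly :: "'n::finite rpoly \<Rightarrow> real ^ 'n \<Rightarrow> real" where
  "eval_poly p x =
     (\<Sum>\<alpha>\<in>Poly_Mapping.keys p.
        Poly_Mapping.lookup p \<alpha> * (\<Prod>i\<in>UNIV. (x $ i) ^ Poly_Mapping.lookup \<alpha> i))"

text \<open>
  The Taylor polynomial of degree at most \<open>m\<close> at the origin of a polynomial is its truncation.
\<close>

definition jet :: "nat \<Rightarrow> 'n::finite rpoly \<Rightarrow> 'n rpoly" where
  "jet m p = Poly_Mapping.mapp (\<lambda>\<alpha> c. c when mdeg \<alpha> \<le> m) p"

definition jet_ring :: "nat \<Rightarrow> 'n::finite rpoly ring" where
  "jet_ring m =
     \<lparr>carrier = {p. \<forall>\<alpha>\<in>Poly_Mapping.keys p. mdeg \<alpha> \<le> m},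
      mult = (\<lambda>p q. jet m (p * q)), one = 1, zero = 0, add = (+)\<rparr>"

definition jets0 :: "nat \<Rightarrow> 'n::finite rpoly set" where
  "jets0 m = {p \<in> carrier (jet_ring m). Poly_Mapping.lookup p 0 = 0}"

definition homogeneous :: "nat \<Rightarrow> 'n::finite rpoly \<Rightarrow> bool" where
  "homogeneous k p \<longleftrightarrow> (\<forall>\<alpha>\<in>Poly_Mapping.keys p. mdeg \<alpha> = k)"

definition is_lowest_part :: "'n::finite rpoly \<Rightarrow> 'n rpoly \<Rightarrow> bool" where
  "is_lowest_part p h \<longleftrightarrow>
     (\<exists>k q. p = h + q \<and> h \<noteq> 0 \<and> homogeneous k h \<and> (\<forall>\<alpha>\<in>Poly_Mapping.keys q. k < mdeg \<alpha>))"

text \<open>Meaningful for \<open>p \<noteq> 0\<close> only; see \<open>is_lowest_part_ex1\<close> below.\<close>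

definition lowest_part :: "'n::finite rpoly \<Rightarrow> 'n rpoly" where
  "lowest_part p = (THE h. is_lowest_part p h)"

definition direction_cone :: "real ^ 'n::finite \<Rightarrow> real \<Rightarrow> real \<Rightarrow> (real ^ 'n) set" where
  "direction_cone \<omega> \<delta> r = {x. 0 < norm x \<and> norm x < r \<and> norm (x /\<^sub>R norm x - \<omega>) < \<delta>}"

definition forbidden_direction :: "nat \<Rightarrow> 'n::finite rpoly set \<Rightarrow> real ^ 'n \<Rightarrow> bool" where
  "forbidden_direction m I \<omega> \<longleftrightarrow>
     (\<exists>(L::nat) q c \<delta> r. 1 \<le> L \<and> (\<forall>l\<in>{1..L}. q l \<in> I) \<and> 0 < c \<and> 0 < \<delta> \<and> 0 < r \<and>
        (\<forall>x\<in>direction_cone \<omega> \<delta> r. c * norm x ^ m < (\<Sum>l=1..L. \<bar>eval_poly (q l) x\<bar>)))"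

definition Allow :: "nat \<Rightarrow> 'n::finite rpoly set \<Rightarrow> (real ^ 'n) set" where
  "Allow m I = {\<omega> \<in> sphere 0 1. \<not> forbidden_direction m I \<omega>}"

lemma lookup_jet:
  "Poly_Mapping.lookup (jet m p) \<alpha> = (Poly_Mapping.lookup p \<alpha> when mdeg \<alpha> \<le> m)"
  by (auto simp: jet_def lookup_mapp when_def in_keys_iff)

lemma keys_jet: "Poly_Mapping.keys (jet m p) = {\<alpha> \<in> Poly_Mapping.keys p. mdeg \<alpha> \<le> m}"
  by (auto simp: in_keys_iff lookup_jet)

lemma jet_add: "jet m (p + q) = jet m p + jet m q"
  by (rule poly_mapping_eqI) (simp add: lookup_jet lookup_add when_def)

lemma jet_id: "\<forall>\<alpha>\<in>Poly_Mapping.keys p. mdeg \<alpha> \<le> m \<Longrightarrow> jet m p = p"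
  by (rule poly_mapping_eqI) (auto simp: lookup_jet when_def in_keys_iff)

lemma jet_eq_0: "\<forall>\<alpha>\<in>Poly_Mapping.keys p. m < mdeg \<alpha> \<Longrightarrow> jet m p = 0"
  by (rule poly_mapping_eqI) (force simp: lookup_jet when_def in_keys_iff)

lemma mdeg_add: "mdeg (\<alpha> + \<beta>) = mdeg \<alpha> + mdeg \<beta>"
  by (simp add: mdeg_def lookup_add sum.distrib)

lemma jet_jet_mult: "jet m (jet m p * q) = jet m (p * q)"
proof -
  have "\<forall>\<alpha>\<in>Poly_Mapping.keys (p - jet m p). m < mdeg \<alpha>"
    by (auto simp: in_keys_iff lookup_jet lookup_minus when_def split: if_splits)
  then have "\<forall>\<alpha>\<in>Poly_Mapping.keys ((p - jet m p) * q). m < mdeg \<alpha>"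
    using keys_mult[of "p - jet m p" q] by (fastforce simp: mdeg_add)
  then have "jet m ((p - jet m p) * q) = 0"
    by (rule jet_eq_0)
  moreover have "p * q = jet m p * q + (p - jet m p) * q"
    by (simp add: algebra_simps)
  ultimately show ?thesis
    by (metis jet_add add.right_neutral)
qed

lemma cring_jet_ring: "cring (jet_ring m :: 'n::finite rpoly ring)"
proof (rule cringI)
  show "abelian_group (jet_ring m :: 'n rpoly ring)"
  proof (rule abelian_groupI)
    fix x y :: "'n rpoly"
    assume "x \<in> carrier (jet_ring m)" "y \<in> carrier (jet_ring m)"
    then show "x \<oplus>\<^bsub>jet_ring m\<^esub> y \<in> carrier (jet_ring m)"
      using Poly_Mapping.keys_add[of x y] by (auto simp: jet_ring_def)
  next
    fix x :: "'n rpoly"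
    assume "x \<in> carrier (jet_ring m)"
    then show "\<exists>y\<in>carrier (jet_ring m). y \<oplus>\<^bsub>jet_ring m\<^esub> x = \<zero>\<^bsub>jet_ring m\<^esub>"
      by (intro bexI[of _ "- x"]) (auto simp: jet_ring_def in_keys_iff)
  qed (auto simp: jet_ring_def algebra_simps)
  show "comm_monoid (jet_ring m :: 'n rpoly ring)"
  proof (rule comm_monoidI)
    fix x y z :: "'n rpoly"
    show "x \<otimes>\<^bsub>jet_ring m\<^esub> y \<otimes>\<^bsub>jet_ring m\<^esub> z = x \<otimes>\<^bsub>jet_ring m\<^esub> (y \<otimes>\<^bsub>jet_ring m\<^esub> z)"
      by (simp add: jet_ring_def jet_jet_mult)
        (metis jet_jet_mult mult.assoc mult.commute)
  qed (auto simp: jet_ring_def keys_jet jet_id mult.commute mdeg_def)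
qed (simp add: jet_ring_def jet_add distrib_right)

lemma is_lowest_part_ex1:
  assumes "p \<noteq> 0"
  shows "\<exists>!h. is_lowest_part p h"
proof
  define k where "k = Min (mdeg ` Poly_Mapping.keys p)"
  define h where "h = jet k p"
  have ne: "Poly_Mapping.keys p \<noteq> {}"
    using assms by simp
  have k_le: "k \<le> mdeg \<alpha>" if "\<alpha> \<in> Poly_Mapping.keys p" for \<alpha>
    using that by (simp add: k_def)
  have "k \<in> mdeg ` Poly_Mapping.keys p"
    unfolding k_def using ne by (intro Min_in) auto
  then have "Poly_Mapping.keys h \<noteq> {}"
    by (auto simp: h_def keys_jet)
  then have "h \<noteq> 0"
    by auto
  moreover have "homogeneous k h"
    using k_le by (auto simp: homogeneous_def h_def keys_jet intro: antisym)
  moreover have "\<forall>\<alpha>\<in>Poly_Mapping.keys (p - h). k < mdeg \<alpha>"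
    by (auto simp: h_def in_keys_iff lookup_jet lookup_minus when_def split: if_splits)
  ultimately show "is_lowest_part p h"
    unfolding is_lowest_part_def by (intro exI[of _ k] exI[of _ "p - h"]) simp
  fix h' assume "is_lowest_part p h'"
  then obtain k' q where q: "p = h' + q" "h' \<noteq> 0" "homogeneous k' h'"
    "\<forall>\<alpha>\<in>Poly_Mapping.keys q. k' < mdeg \<alpha>"
    unfolding is_lowest_part_def by blast
  have h': "h' = jet k' p"
    using q by (simp add: jet_add jet_eq_0 jet_id homogeneous_def)
  have deg: "mdeg \<alpha> \<ge> k'" if "\<alpha> \<in> Poly_Mapping.keys p" for \<alpha>
    using that q Poly_Mapping.keys_add[of h' q] by (force simp: homogeneous_def)
  from q(2) have "Poly_Mapping.keys h' \<noteq> {}"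
    by simp
  then obtain \<beta> where "\<beta> \<in> Poly_Mapping.keys p" "mdeg \<beta> \<le> k'"
    using h' keys_jet by fastforce
  then have "k \<le> k'"
    using k_le le_trans by blast
  moreover have "k' \<le> k"
    using deg \<open>k \<in> mdeg ` Poly_Mapping.keys p\<close> by auto
  ultimately show "h' = h"
    using h' h_def by simp
qed

end

theory Submission
  imports Defs
begin

text \<open>Near the origin a polynomial is governed by its lowest degree part. If the lowest part
  \<open>h\<close> of a generator, of degree k, does not vanish at \<omega>, then by continuity and
  homogeneity |h(x)| is at least a constant times |x|^k on a cone around \<omega>, while the other
  terms are O(|x|^(k+1)). As k \<le> m, this one generator exceeds a multiple of |x|^m on a small
  cone, so \<omega> is forbidden: \<open>forbidden_direction_if_lowest_part_nonzero\<close>.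

  For the converse with homogeneous generators, a common zero \<omega> is a common zero of the whole
  ray through \<omega>. The jets that are O(s^(m+1)) at the points s\<omega> form an ideal
  (\<open>ideal_ray_ideal\<close>); it contains the generators, hence I. Finitely many such jets
  cannot dominate c s^m at the points s\<omega>, which meet every cone around \<omega>, so \<omega>
  is allowed: \<open>not_forbidden_direction_if_subset_ray_ideal\<close>.\<close>

section \<open>Evaluation of polynomials and bounds near the origin\<close>

text \<open>Cancellation can shrink the support of a sum, so evaluations are compared over a common
  finite index set.\<close>

lemma eval_poly_superset:
  assumes "finite A" "Poly_Mapping.keys p \<subseteq> A"
  shows "eval_poly p x =
    (\<Sum>\<alpha>\<in>A. Poly_Mapping.lookup p \<alpha> * (\<Prod>i\<in>UNIV. (x $ i) ^ Poly_Mapping.lookup \<alpha> i))"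
  unfolding eval_poly_def
  by (rule sum.mono_neutral_left) (use assms in \<open>auto simp: in_keys_iff\<close>)

lemma eval_poly_0 [simp]: "eval_poly 0 x = 0"
  by (simp add: eval_poly_def)

lemma eval_poly_add: "eval_poly (p + q) x = eval_poly p x + eval_poly q x"
proof -
  let ?A = "Poly_Mapping.keys p \<union> Poly_Mapping.keys q"
  have "Poly_Mapping.keys (p + q) \<subseteq> ?A"
    by (rule Poly_Mapping.keys_add)
  then show ?thesis
    by (simp add: eval_poly_superset[of ?A] lookup_add distrib_right sum.distrib)
qed

lemma eval_poly_uminus: "eval_poly (- p) x = - eval_poly p x"
  using eval_poly_add[of p "- p" x] by simp

lemma eval_poly_diff: "eval_poly (p - q) x = eval_poly p x - eval_poly q x"
  using eval_poly_add[of "p - q" q x] by simp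

lemma eval_poly_single:
  "eval_poly (Poly_Mapping.single \<alpha> c) x = c * (\<Prod>i\<in>UNIV. (x $ i) ^ Poly_Mapping.lookup \<alpha> i)"
  by (subst eval_poly_superset[of "{\<alpha>}"]) auto

text \<open>Updating a coefficient outside the support amounts to adding a monomial, a form to which
  additivity of evaluation applies.\<close>

lemma poly_mapping_induct_add_single [case_names zero add]:
  assumes "P 0" and "\<And>f \<alpha> c. P f \<Longrightarrow> P (Poly_Mapping.single \<alpha> c + f)"
  shows "P (p :: 'a \<Rightarrow>\<^sub>0 'b::comm_monoid_add)"
proof (induction p rule: update_induct)
  case (update f \<alpha> c)
  then have "Poly_Mapping.update \<alpha> c f = Poly_Mapping.single \<alpha> c + f"
    by (intro poly_mapping_eqI) (auto simp: lookup_update lookup_add lookup_single in_keys_iff when_def)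
  then show ?case
    using assms(2)[OF update(3)] by simp
qed (rule assms(1))

text \<open>Both sides are additive in each factor, so a nested induction reduces the claim to two
  monomials, whose exponents add.\<close>

lemma eval_poly_mult: "eval_poly (p * q) x = eval_poly p x * eval_poly q x"
proof (induction p rule: poly_mapping_induct_add_single)
  case (add f \<alpha> c)
  have "eval_poly (Poly_Mapping.single \<alpha> c * q) x = eval_poly (Poly_Mapping.single \<alpha> c) x * eval_poly q x"
    by (induction q rule: poly_mapping_induct_add_single)
      (simp_all add: distrib_left eval_poly_add mult_single eval_poly_single lookup_add power_add
        prod.distrib)
  with add show ?case
    by (simp add: distrib_right eval_poly_add)
qed simp

lemma eval_poly_scaleR_homogeneous:
  assumes "homogeneous k p"
  shows "eval_poly p (s *\<^sub>R x) = s ^ k * eval_poly p x"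
proof -
  have "(\<Prod>i\<in>UNIV. ((s *\<^sub>R x) $ i) ^ Poly_Mapping.lookup \<alpha> i)
      = s ^ k * (\<Prod>i\<in>UNIV. (x $ i) ^ Poly_Mapping.lookup \<alpha> i)"
    if "\<alpha> \<in> Poly_Mapping.keys p" for \<alpha>
  proof -
    have "mdeg \<alpha> = k"
      using assms that by (auto simp: homogeneous_def)
    then have "s ^ k = (\<Prod>i\<in>UNIV. s ^ Poly_Mapping.lookup \<alpha> i)"
      by (auto simp: mdeg_def power_sum)
    then show ?thesis
      by (simp add: power_mult_distrib prod.distrib)
  qed
  then show ?thesis
    by (simp add: eval_poly_def sum_distrib_left mult.left_commute)
qed

text \<open>Each coordinate is at most the norm, so a monomial of degree d is at most |x|^d, hence
  at most |x|^k in the unit ball when d \<ge> k. The sum of the absolute coefficients serves as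
  \<open>C\<close>.\<close>

lemma abs_eval_poly_le:
  fixes p :: "'n::finite rpoly"
  assumes "\<And>\<alpha>. \<alpha> \<in> Poly_Mapping.keys p \<Longrightarrow> k \<le> mdeg \<alpha>"
  obtains C where "0 \<le> C" "\<And>x. norm x \<le> 1 \<Longrightarrow> \<bar>eval_poly p x\<bar> \<le> C * norm x ^ k"
proof
  let ?C = "\<Sum>\<alpha>\<in>Poly_Mapping.keys p. \<bar>Poly_Mapping.lookup p \<alpha>\<bar>"
  show "0 \<le> ?C"
    by (simp add: sum_nonneg)
  fix x :: "real ^ 'n"
  assume x: "norm x \<le> 1"
  have "\<bar>\<Prod>i\<in>UNIV. (x $ i) ^ Poly_Mapping.lookup \<alpha> i\<bar> \<le> norm x ^ k"
    if "\<alpha> \<in> Poly_Mapping.keys p" for \<alpha>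
  proof -
    have "\<bar>\<Prod>i\<in>UNIV. (x $ i) ^ Poly_Mapping.lookup \<alpha> i\<bar>
        \<le> (\<Prod>i\<in>(UNIV :: 'n set). norm x ^ Poly_Mapping.lookup \<alpha> i)"
      by (auto simp: abs_prod power_abs intro!: prod_mono power_mono component_le_norm_cart)
    also have "\<dots> = norm x ^ mdeg \<alpha>"
      by (simp add: mdeg_def power_sum)
    also have "\<dots> \<le> norm x ^ k"
      using assms[OF that] x by (simp add: power_decreasing)
    finally show ?thesis .
  qed
  then show "\<bar>eval_poly p x\<bar> \<le> ?C * norm x ^ k"
    unfolding eval_poly_def sum_distrib_right
    by (intro order_trans[OF sum_abs] sum_mono) (simp add: abs_mult mult_left_mono)
qed

lemma continuous_on_eval_poly: "continuous_on S (eval_poly p)"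
  unfolding eval_poly_def by (intro continuous_intros)

section \<open>Lowest degree parts and forbidden directions\<close>

lemma is_lowest_part_lowest_part: "p \<noteq> 0 \<Longrightarrow> is_lowest_part p (lowest_part p)"
  unfolding lowest_part_def by (rule theI') (rule is_lowest_part_ex1)

lemma lowest_part_homogeneous:
  assumes "homogeneous k p" "p \<noteq> 0"
  shows "lowest_part p = p"
proof -
  have "is_lowest_part p p"
    unfolding is_lowest_part_def using assms by (intro exI[of _ k] exI[of _ 0]) simp
  then show ?thesis
    using is_lowest_part_ex1[OF assms(2)] is_lowest_part_lowest_part[OF assms(2)] by blast
qed

text \<open>On a thin and short cone around \<omega> the lowest part dominates the rest of
  \<open>p\<close>, so \<open>p\<close> alone witnesses that \<omega> is forbidden.\<close>

lemma forbidden_direction_if_lowest_part_nonzero: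
  fixes p :: "'n::finite rpoly"
  assumes p: "p \<in> carrier (jet_ring m)" "p \<in> I" "p \<noteq> 0"
    and nz: "eval_poly (lowest_part p) \<omega> \<noteq> 0"
  shows "forbidden_direction m I \<omega>"
proof -
  define h where "h = lowest_part p"
  obtain k q where q: "p = h + q" "h \<noteq> 0" "homogeneous k h"
    "\<And>\<alpha>. \<alpha> \<in> Poly_Mapping.keys q \<Longrightarrow> k < mdeg \<alpha>"
    using is_lowest_part_lowest_part[OF p(3)] unfolding is_lowest_part_def h_def by metis
  \<comment> \<open>All monomials of \<open>q\<close> have degree above \<open>k\<close>, so none
    cancels a monomial of \<open>h\<close>; the degree bound on \<open>p\<close> therefore applies
    to \<open>h\<close>.\<close>
  have "k \<le> m"
  proof -
    obtain \<alpha> where \<alpha>: "\<alpha> \<in> Poly_Mapping.keys h"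
      using q(2) by (metis all_not_in_conv keys_eq_empty)
    then have "mdeg \<alpha> = k"
      using q(3) by (simp add: homogeneous_def)
    moreover have "\<alpha> \<notin> Poly_Mapping.keys q"
      using q(4) \<open>mdeg \<alpha> = k\<close> by blast
    ultimately have "\<alpha> \<in> Poly_Mapping.keys p"
      using \<alpha> by (simp add: q(1) in_keys_iff lookup_add)
    then show ?thesis
      using p(1) \<open>mdeg \<alpha> = k\<close> by (auto simp: jet_ring_def)
  qed
  obtain C where C: "0 \<le> C" "\<And>x. norm x \<le> 1 \<Longrightarrow> \<bar>eval_poly q x\<bar> \<le> C * norm x ^ Suc k"
    using abs_eval_poly_le[of q "Suc k"] q(4) by (metis Suc_leI)
  \<comment> \<open>Half of the value at \<omega>: a deviation of less than \<open>a\<close> leaves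
    at least \<open>a\<close>.\<close>
  define a where "a = \<bar>eval_poly h \<omega>\<bar> / 2"
  have a: "0 < a"
    using nz by (simp add: a_def h_def)
  have "isCont (eval_poly h) \<omega>"
    using continuous_on_eval_poly[of UNIV h] by (simp add: continuous_on_eq_continuous_at)
  then obtain \<delta> where \<delta>: "0 < \<delta>" "\<And>y. dist y \<omega> < \<delta> \<Longrightarrow> dist (eval_poly h y) (eval_poly h \<omega>) < a"
    using a unfolding continuous_at_eps_delta by metis
  have h_ge: "a \<le> \<bar>eval_poly h y\<bar>" if "norm (y - \<omega>) < \<delta>" for y
    using \<delta>(2)[of y] that unfolding dist_norm real_norm_def a_def by linarith
  \<comment> \<open>The second bound makes the tail at most half of the main term;
    \<open>C + 1\<close> avoids division by zero. The bound 1 allows powers of the norm to be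
    compared.\<close>
  define r where "r = min 1 (a / (2 * (C + 1)))"
  have r: "0 < r" "r \<le> 1" "C * r \<le> a / 2"
  proof -
    show "0 < r" "r \<le> 1"
      using a C(1) by (auto simp: r_def)
    have "C * r \<le> (C + 1) * (a / (2 * (C + 1)))"
      using C(1) \<open>0 < r\<close> by (intro mult_mono) (auto simp: r_def)
    also have "\<dots> = a / 2"
      using C(1) by (simp add: field_simps)
    finally show "C * r \<le> a / 2" .
  qed
  \<comment> \<open>The main term minus the tail leaves \<open>a / 2\<close> times |x|^k; halving
    once more makes the inequality strict.\<close>
  have "a / 4 * norm x ^ m < (\<Sum>l = 1..1::nat. \<bar>eval_poly p x\<bar>)"
    if "x \<in> direction_cone \<omega> \<delta> r" for x
  proof -
    define y where "y = x /\<^sub>R norm x"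
    have x: "0 < norm x" "norm x < r" "norm (y - \<omega>) < \<delta>"
      using that by (auto simp: direction_cone_def y_def)
    have "x = norm x *\<^sub>R y"
      using x(1) by (simp add: y_def)
    then have "\<bar>eval_poly h x\<bar> = norm x ^ k * \<bar>eval_poly h y\<bar>"
      using eval_poly_scaleR_homogeneous[OF q(3), of "norm x" y] by (simp add: abs_mult)
    then have 1: "norm x ^ k * a \<le> \<bar>eval_poly h x\<bar>"
      using h_ge[OF x(3)] by (simp add: mult_left_mono)
    have "C * norm x \<le> C * r"
      using x(2) C(1) by (intro mult_left_mono) auto
    then have "C * norm x \<le> a / 2"
      using r(3) by linarith
    then have "(C * norm x) * norm x ^ k \<le> a / 2 * norm x ^ k"
      by (intro mult_right_mono) auto
    moreover have "\<bar>eval_poly q x\<bar> \<le> (C * norm x) * norm x ^ k"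
      using C(2)[of x] x(2) r(2) by (simp add: mult.assoc)
    ultimately have 2: "\<bar>eval_poly q x\<bar> \<le> a / 2 * norm x ^ k"
      by linarith
    have "norm x ^ m \<le> norm x ^ k"
      using \<open>k \<le> m\<close> x(2) r(2) by (intro power_decreasing) auto
    then have "a / 4 * norm x ^ m \<le> a / 4 * norm x ^ k"
      using a by (intro mult_left_mono) auto
    also have "\<dots> < a / 2 * norm x ^ k"
      using a x(1) by simp
    also have "\<dots> \<le> \<bar>eval_poly p x\<bar>"
      using 1 2 unfolding q(1) eval_poly_add mult.commute[of "norm x ^ k"] by linarith
    finally show ?thesis
      by simp
  qed
  then show ?thesis
    unfolding forbidden_direction_def
    by (intro exI[of _ "1::nat"] exI[of _ "\<lambda>_. p"] exI[of _ "a / 4"] exI[of _ \<delta>] exI[of _ r])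
      (use p(2) a \<delta>(1) r(1) in auto)
qed

section \<open>Jets of order above m along a ray\<close>

text \<open>
  Demanding a bound instead of vanishing along the ray makes closedness under the truncated
  product immediate: the discarded terms have order at least \<open>m + 1\<close>.
\<close>

definition ray_ideal :: "nat \<Rightarrow> real ^ 'n::finite \<Rightarrow> 'n rpoly set" where
  "ray_ideal m \<omega> = {q \<in> carrier (jet_ring m).
     \<exists>C\<ge>0. \<forall>s\<in>{0..1}. \<bar>eval_poly q (s *\<^sub>R \<omega>)\<bar> \<le> C * s ^ Suc m}"

text \<open>The inverse of the ring structure is derived from its addition, so it is identified with
  negation before \<open>eval_poly_uminus\<close> can be used.\<close>

lemma a_inv_jet_ring:
  fixes p :: "'n::finite rpoly"
  assumes "p \<in> carrier (jet_ring m)"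
  shows "\<ominus>\<^bsub>jet_ring m\<^esub> p = - p"
proof -
  interpret cring "jet_ring m :: 'n rpoly ring"
    by (rule cring_jet_ring)
  have "- p \<in> carrier (jet_ring m)"
    using assms by (auto simp: jet_ring_def in_keys_iff)
  then show ?thesis
    using assms by (intro minus_equality) (auto simp: jet_ring_def)
qed

text \<open>The factor \<open>a\<close> is bounded on the unit ball, so the full product keeps the
  order of \<open>q\<close> along the ray; the truncated part \<open>d\<close> has only monomials of
  degree at least m + 1.\<close>

lemma ray_ideal_jet_mult:
  fixes a q :: "'n::finite rpoly"
  assumes q: "q \<in> ray_ideal m \<omega>" and \<omega>: "norm \<omega> = 1"
  shows "jet m (a * q) \<in> ray_ideal m \<omega>"
proof -
  obtain C where C: "0 \<le> C"
    "\<And>s. s \<in> {0..1} \<Longrightarrow> \<bar>eval_poly q (s *\<^sub>R \<omega>)\<bar> \<le> C * s ^ Suc m"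
    using q by (auto simp: ray_ideal_def)
  obtain A where A: "0 \<le> A" "\<And>x. norm x \<le> 1 \<Longrightarrow> \<bar>eval_poly a x\<bar> \<le> A * norm x ^ 0"
    using abs_eval_poly_le[of a 0] by auto
  define d where "d = a * q - jet m (a * q)"
  have "Suc m \<le> mdeg \<alpha>" if "\<alpha> \<in> Poly_Mapping.keys d" for \<alpha>
    using that by (auto simp: d_def in_keys_iff lookup_minus lookup_jet when_def split: if_splits)
  then obtain D where D: "0 \<le> D" "\<And>x. norm x \<le> 1 \<Longrightarrow> \<bar>eval_poly d x\<bar> \<le> D * norm x ^ Suc m"
    using abs_eval_poly_le[of d "Suc m"] by blast
  have "\<bar>eval_poly (jet m (a * q)) (s *\<^sub>R \<omega>)\<bar> \<le> (A * C + D) * s ^ Suc m" if s: "s \<in> {0..1}" for s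
  proof -
    let ?x = "s *\<^sub>R \<omega>"
    have n: "norm ?x = s"
      using s \<omega> by simp
    have "jet m (a * q) = a * q - d"
      by (simp add: d_def)
    then have "\<bar>eval_poly (jet m (a * q)) ?x\<bar>
        \<le> \<bar>eval_poly a ?x\<bar> * \<bar>eval_poly q ?x\<bar> + \<bar>eval_poly d ?x\<bar>"
      by (metis abs_mult abs_triangle_ineq4 eval_poly_diff eval_poly_mult)
    also have "\<dots> \<le> A * (C * s ^ Suc m) + D * s ^ Suc m"
      using A(2)[of ?x] C(2)[OF s] D(2)[of ?x] A(1) n s
      by (intro add_mono mult_mono) auto
    finally show ?thesis
      by (simp add: algebra_simps)
  qed
  moreover have "0 \<le> A * C + D"
    using A(1) C(1) D(1) by simp
  moreover have "jet m (a * q) \<in> carrier (jet_ring m)"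
    by (simp add: jet_ring_def keys_jet)
  ultimately show ?thesis
    unfolding ray_ideal_def by blast
qed

lemma ideal_ray_ideal:
  fixes \<omega> :: "real ^ 'n::finite"
  assumes "norm \<omega> = 1"
  shows "ideal (ray_ideal m \<omega>) (jet_ring m)"
proof -
  interpret cring "jet_ring m :: 'n rpoly ring"
    by (rule cring_jet_ring)
  have closed: "p + q \<in> ray_ideal m \<omega>" if p: "p \<in> ray_ideal m \<omega>" and q: "q \<in> ray_ideal m \<omega>" for p q
  proof -
    obtain C where C: "0 \<le> C"
      "\<And>s. s \<in> {0..1} \<Longrightarrow> \<bar>eval_poly p (s *\<^sub>R \<omega>)\<bar> \<le> C * s ^ Suc m"
      using p by (auto simp: ray_ideal_def)
    obtain D where D: "0 \<le> D"
      "\<And>s. s \<in> {0..1} \<Longrightarrow> \<bar>eval_poly q (s *\<^sub>R \<omega>)\<bar> \<le> D * s ^ Suc m"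
      using q by (auto simp: ray_ideal_def)
    have "\<bar>eval_poly (p + q) (s *\<^sub>R \<omega>)\<bar> \<le> (C + D) * s ^ Suc m" if "s \<in> {0..1}" for s
      using C(2)[OF that] D(2)[OF that] unfolding eval_poly_add distrib_right by linarith
    moreover have "p + q \<in> carrier (jet_ring m)"
      using p q a_closed[of p q] by (simp add: ray_ideal_def jet_ring_def)
    moreover have "0 \<le> C + D"
      using C(1) D(1) by simp
    ultimately show ?thesis
      unfolding ray_ideal_def by blast
  qed
  have subgroup: "subgroup (ray_ideal m \<omega>) (add_monoid (jet_ring m))"
  proof (rule add.subgroupI)
    show "ray_ideal m \<omega> \<subseteq> carrier (jet_ring m)"
      by (auto simp: ray_ideal_def)
    have "0 \<in> ray_ideal m \<omega>"
      by (auto simp: ray_ideal_def jet_ring_def)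
    then show "ray_ideal m \<omega> \<noteq> {}"
      by blast
  next
    fix p assume p: "p \<in> ray_ideal m \<omega>"
    then have "p \<in> carrier (jet_ring m)"
      by (simp add: ray_ideal_def)
    then have "\<ominus>\<^bsub>jet_ring m\<^esub> p = - p" "- p \<in> carrier (jet_ring m)"
      using a_inv_jet_ring a_inv_closed by metis+
    then show "\<ominus>\<^bsub>jet_ring m\<^esub> p \<in> ray_ideal m \<omega>"
      using p by (auto simp: ray_ideal_def eval_poly_uminus)
  qed (use closed in \<open>simp add: jet_ring_def\<close>)
  show ?thesis
  proof (rule idealI[OF ring_axioms subgroup])
    fix q a assume q: "q \<in> ray_ideal m \<omega>"
    show "a \<otimes>\<^bsub>jet_ring m\<^esub> q \<in> ray_ideal m \<omega>"
      using ray_ideal_jet_mult[OF q assms] by (simp add: jet_ring_def)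
    then show "q \<otimes>\<^bsub>jet_ring m\<^esub> a \<in> ray_ideal m \<omega>"
      by (simp add: jet_ring_def mult.commute)
  qed
qed

text \<open>The point s\<omega> has direction exactly \<omega>, so it lies in every cone around
  \<omega> once s < r. There a finite sum of absolute values is O(s^(m+1)), which contradicts the
  lower bound c s^m for small s.\<close>

lemma not_forbidden_direction_if_subset_ray_ideal:
  fixes \<omega> :: "real ^ 'n::finite"
  assumes \<omega>: "norm \<omega> = 1" and I: "I \<subseteq> ray_ideal m \<omega>"
  shows "\<not> forbidden_direction m I \<omega>"
proof
  assume "forbidden_direction m I \<omega>"
  then obtain L q c \<delta> r where q: "\<And>l. l \<in> {1..L::nat} \<Longrightarrow> q l \<in> I" and pos: "0 < c" "0 < \<delta>" "0 < r"
    and lt: "\<And>x. x \<in> direction_cone \<omega> \<delta> r \<Longrightarrow> c * norm x ^ m < (\<Sum>l=1..L. \<bar>eval_poly (q l) x\<bar>)"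
    unfolding forbidden_direction_def by blast
  have "\<forall>l\<in>{1..L}. \<exists>C\<ge>0. \<forall>s\<in>{0..1}. \<bar>eval_poly (q l) (s *\<^sub>R \<omega>)\<bar> \<le> C * s ^ Suc m"
    using q I by (force simp: ray_ideal_def)
  then obtain C where C: "\<And>l. l \<in> {1..L} \<Longrightarrow> 0 \<le> C l"
    "\<And>l s. l \<in> {1..L} \<Longrightarrow> s \<in> {0..1} \<Longrightarrow> \<bar>eval_poly (q l) (s *\<^sub>R \<omega>)\<bar> \<le> C l * s ^ Suc m"
    by metis
  \<comment> \<open>The summand 1 keeps \<open>D\<close> positive even if all \<open>C l\<close>
    vanish, so that \<open>c / D\<close> is usable.\<close>
  define D where "D = (\<Sum>l=1..L. C l) + 1"
  have D: "0 < D"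
    using C(1) by (auto simp: D_def intro!: add_nonneg_pos sum_nonneg)
  \<comment> \<open>Small enough for the ray bounds, for s < r, and for D s \<le> c.\<close>
  define s where "s = min (min 1 (r / 2)) (c / D)"
  have s: "0 < s" "s \<le> 1" "s < r" "s \<le> c / D"
    using pos D by (auto simp: s_def)
  have n: "norm (s *\<^sub>R \<omega>) = s"
    using s(1) \<omega> by simp
  have "s *\<^sub>R \<omega> \<in> direction_cone \<omega> \<delta> r"
    using s pos(2) unfolding direction_cone_def mem_Collect_eq n by simp
  then have "c * s ^ m < (\<Sum>l=1..L. \<bar>eval_poly (q l) (s *\<^sub>R \<omega>)\<bar>)"
    using lt n by metis
  also have "\<dots> \<le> (\<Sum>l=1..L. C l * s ^ Suc m)"
    using C(2) s by (intro sum_mono) auto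
  also have "\<dots> \<le> D * s ^ Suc m"
    using s(1) by (simp add: D_def flip: sum_distrib_right)
  also have "\<dots> = (D * s) * s ^ m"
    by simp
  also have "\<dots> \<le> c * s ^ m"
    using s D by (intro mult_right_mono) (auto simp: field_simps)
  finally show False
    by simp
qed

section \<open>Allowed directions of a generated ideal\<close>

theorem corollary3p3:
  fixes m t :: nat
    and p :: "nat \<Rightarrow> 'n::finite rpoly"
    and I :: "'n rpoly set"
  assumes "1 \<le> m" and "1 \<le> t"
    and "\<And>i. i \<in> {1..t} \<Longrightarrow> p i \<in> jets0 m"
    and "\<And>i. i \<in> {1..t} \<Longrightarrow> p i \<noteq> 0"
    and "I = Idl\<^bsub>jet_ring m\<^esub> (p ` {1..t})"
  shows "Allow m I \<subseteq> (\<Inter>i\<in>{1..t}. {\<omega> \<in> sphere 0 1. eval_poly (lowest_part (p i)) \<omega> = 0}) \<and>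
    ((\<forall>i\<in>{1..t}. \<exists>k. homogeneous k (p i)) \<longrightarrow>
      Allow m I = (\<Inter>i\<in>{1..t}. {\<omega> \<in> sphere 0 1. eval_poly (p i) \<omega> = 0}))"
proof -
  interpret cring "jet_ring m :: 'n rpoly ring"
    by (rule cring_jet_ring)
  have carrier: "p i \<in> carrier (jet_ring m)" if "i \<in> {1..t}" for i
    using assms(3)[OF that] by (simp add: jets0_def)
  then have "p ` {1..t} \<subseteq> carrier (jet_ring m)"
    by blast
  then have in_I: "p i \<in> I" if "i \<in> {1..t}" for i
    using genideal_self that assms(5) by blast
  have sub: "Allow m I \<subseteq> (\<Inter>i\<in>{1..t}. {\<omega> \<in> sphere 0 1. eval_poly (lowest_part (p i)) \<omega> = 0})"
  proof (intro subsetI INT_I CollectI conjI)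
    fix \<omega> i assume "\<omega> \<in> Allow m I" and i: "i \<in> {1..t}"
    then show "\<omega> \<in> sphere 0 1" "eval_poly (lowest_part (p i)) \<omega> = 0"
      using forbidden_direction_if_lowest_part_nonzero[OF carrier[OF i] in_I[OF i] assms(4)[OF i]]
      unfolding Allow_def by blast+
  qed
  moreover have "Allow m I = (\<Inter>i\<in>{1..t}. {\<omega> \<in> sphere 0 1. eval_poly (p i) \<omega> = 0})"
    if hom: "\<forall>i\<in>{1..t}. \<exists>k. homogeneous k (p i)"
  proof
    have lowest: "lowest_part (p i) = p i" if "i \<in> {1..t}" for i
      using hom lowest_part_homogeneous assms(4) that by blast
    show "Allow m I \<subseteq> (\<Inter>i\<in>{1..t}. {\<omega> \<in> sphere 0 1. eval_poly (p i) \<omega> = 0})"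
      using sub lowest unfolding subset_iff INT_iff mem_Collect_eq by metis
  next
    show "(\<Inter>i\<in>{1..t}. {\<omega> \<in> sphere 0 1. eval_poly (p i) \<omega> = 0}) \<subseteq> Allow m I"
    proof
      fix \<omega> assume *: "\<omega> \<in> (\<Inter>i\<in>{1..t}. {\<omega> \<in> sphere 0 1. eval_poly (p i) \<omega> = 0})"
      \<comment> \<open>Here t \<ge> 1 matters: an empty intersection would not confine \<omega> to
        the sphere.\<close>
      then have \<omega>: "norm \<omega> = 1"
        using assms(2) by auto
      have "p i \<in> ray_ideal m \<omega>" if i: "i \<in> {1..t}" for i
      proof -
        \<comment> \<open>Homogeneity spreads the zero at \<omega> along the whole line, so the
          bound defining \<open>ray_ideal\<close> is trivial.\<close>
        have "eval_poly (p i) (s *\<^sub>R \<omega>) = 0" for s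
        proof -
          obtain k where "homogeneous k (p i)"
            using hom i by blast
          moreover have "eval_poly (p i) \<omega> = 0"
            using * i by blast
          ultimately show ?thesis
            by (simp add: eval_poly_scaleR_homogeneous)
        qed
        then show ?thesis
          using carrier[OF i] by (auto simp: ray_ideal_def)
      qed
      \<comment> \<open>\<open>I\<close> is the least ideal containing the generators, so it is
        enough that they lie in the ideal \<open>ray_ideal m \<omega>\<close>.\<close>
      then have "I \<subseteq> ray_ideal m \<omega>"
        unfolding assms(5) by (intro genideal_minimal ideal_ray_ideal \<omega>) blast
      then show "\<omega> \<in> Allow m I"
        using not_forbidden_direction_if_subset_ray_ideal \<omega> by (simp add: Allow_def)
    qed
  qed
  ultimately show ?thesis
    by blast
qed

end
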